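(* Let $\mathbf{k}$ be a field of characteristic $0$, $\lambda\in\mathbf{k}$, let $(\mathfrak g,d_{\mathfrak g})$ be a differential Lie algebra of weight $\lambda$ over $\mathbf k$ and $(V,\rho,d_V)$ a differential representation of it. Then the family of linear maps $\delta^n:\mathrm{C}^n_{\mathrm{Lie}}(\mathfrak g,V)\to \mathrm{C}^n_{\mathrm{DO}_\lambda}(\mathfrak g,V)$, $n\ge 0$, is a cochain map from $(\mathrm{C}^*_{\mathrm{Lie}}(\mathfrak g,V),\partial^*_{\mathrm{Lie}})$ to $(\mathrm{C}^*_{\mathrm{DO}_\lambda}(\mathfrak g,V),\partial^*_{\mathrm{DO}_\lambda})$; that is, $\partial^n_{\mathrm{DO}_\lambda}\circ\delta^n=\delta^{n+1}\circ\partial^n_{\mathrm{Lie}}$ for all $n\ge 0$.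
   Context: A differential Lie algebra of weight $\lambda$ is a Lie algebra $(\mathfrak g,[\,,])$ with a linear map $d_{\mathfrak g}:\mathfrak g\to\mathfrak g$ such that $d_{\mathfrak g}([x,y])=[d_{\mathfrak g}(x),y]+[x,d_{\mathfrak g}(y)]+\lambda[d_{\mathfrak g}(x),d_{\mathfrak g}(y)]$ for all $x,y$. A differential representation is $(V,\rho,d_V)$ with $(V,\rho)$ a representation of the Lie algebra $\mathfrak g$ and $d_V:V\to V$ linear with $d_V(\rho(x)v)=\rho(d_{\mathfrak g}(x))v+\rho(x)d_V(v)+\lambda\rho(d_{\mathfrak g}(x))d_V(v)$. Put $\rho_\lambda(x)v:=\rho(x+\lambda d_{\mathfrak g}(x))v$; then $(V,\rho_\lambda,d_V)$ is again a differential representation. For $n\ge0$, $\mathrm{C}^n_{\mathrm{Lie}}(\mathfrak g,V)=\mathrm{C}^n_{\mathrm{DO}_\lambda}(\mathfrak g,V)=\mathrm{Hom}(\wedge^n\mathfrak g,V)$ (equal to $V$ for $n=0$), with $$\partial^n_{\mathrm{Lie}}(f)(x_1,\dots,x_{n+1})=\sum_{i=1}^{n+1}(-1)^{i+n}\rho(x_i)f(x_1,\dots,\hat x_i,\dots,x_{n+1})+\sum_{1\le i<j\le n+1}(-1)^{i+j+n+1}f([x_i,x_j],x_1,\dots,\hat x_i,\dots,\hat x_j,\dots,x_{n+1}),$$ and $\partial^n_{\mathrm{DO}_\lambda}$ given by the same formula with $\rho$ replaced by $\rho_\lambda$. For $n\ge1$, $$\delta^nf(x_1,\dots,x_n)=\sum_{k=1}^n\lambda^{k-1}\sum_{1\le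 i_1<\dots<i_k\le n}f(x_1,\dots,d_{\mathfrak g}(x_{i_1}),\dots,d_{\mathfrak g}(x_{i_k}),\dots,x_n)-d_Vf(x_1,\dots,x_n)$$ (in the $(i_1,\dots,i_k)$-summand $d_{\mathfrak g}$ is applied exactly to the arguments $x_{i_1},\dots,x_{i_k}$; $\lambda^0=1$), and $\delta^0v=-d_V(v)$. *)

theory Defs
  imports Complex_Main "HOL-Library.Function_Algebras"
begin

locale lie_algebra = vector_space scale
  for scale :: "'k::field \<Rightarrow> 'g::ab_group_add \<Rightarrow> 'g" +
  fixes bracket :: "'g \<Rightarrow> 'g \<Rightarrow> 'g"
  assumes bracket_linear_left: "\<And>y. Vector_Spaces.linear scale scale (\<lambda>x. bracket x y)"
    and bracket_linear_right: "\<And>x. Vector_Spaces.linear scale scale (bracket x)"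
    and bracket_self: "\<And>x. bracket x x = 0"
    and jacobi: "\<And>x y z.
      bracket x (bracket y z) + bracket y (bracket z x) + bracket z (bracket x y) = 0"

locale differential_lie_algebra = lie_algebra scale bracket
  for scale :: "'k::field \<Rightarrow> 'g::ab_group_add \<Rightarrow> 'g"
    and bracket :: "'g \<Rightarrow> 'g \<Rightarrow> 'g" +
  fixes lam :: 'k and dg :: "'g \<Rightarrow> 'g"
  assumes dg_linear: "Vector_Spaces.linear scale scale dg"
    and dg_bracket: "\<And>x y. dg (bracket x y) =
      bracket (dg x) y + bracket x (dg y) + scale lam (bracket (dg x) (dg y))"

locale lie_representation = lie_algebra scale bracket + V: vector_space scaleV
  for scale :: "'k::field \<Rightarrow> 'g::ab_group_add \<Rightarrow> 'g"
    and bracket :: "'g \<Rightarrow> 'g \<Rightarrow> 'g"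
    and scaleV :: "'k \<Rightarrow> 'v::ab_group_add \<Rightarrow> 'v" +
  fixes \<rho> :: "'g \<Rightarrow> 'v \<Rightarrow> 'v"
  assumes rho_linear_left: "\<And>v. Vector_Spaces.linear scale scaleV (\<lambda>x. \<rho> x v)"
    and rho_linear_right: "\<And>x. Vector_Spaces.linear scaleV scaleV (\<rho> x)"
    and rho_bracket: "\<And>x y v. \<rho> (bracket x y) v = \<rho> x (\<rho> y v) - \<rho> y (\<rho> x v)"

locale differential_representation =
  differential_lie_algebra scale bracket lam dg +
  lie_representation scale bracket scaleV \<rho>
  for scale :: "'k::field \<Rightarrow> 'g::ab_group_add \<Rightarrow> 'g"
    and bracket :: "'g \<Rightarrow> 'g \<Rightarrow> 'g"
    and lam :: 'k
    and dg :: "'g \<Rightarrow> 'g"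
    and scaleV :: "'k \<Rightarrow> 'v::ab_group_add \<Rightarrow> 'v"
    and \<rho> :: "'g \<Rightarrow> 'v \<Rightarrow> 'v" +
  fixes dV :: "'v \<Rightarrow> 'v"
  assumes dV_linear: "Vector_Spaces.linear scaleV scaleV dV"
    and dV_rho: "\<And>x v. dV (\<rho> x v) =
      \<rho> (dg x) v + \<rho> x (dV v) + scaleV lam (\<rho> (dg x) (dV v))"

definition rho_lam ::
  "('k \<Rightarrow> 'g \<Rightarrow> 'g) \<Rightarrow> 'k \<Rightarrow> ('g \<Rightarrow> 'g) \<Rightarrow> ('g \<Rightarrow> 'v \<Rightarrow> 'v) \<Rightarrow> 'g::ab_group_add \<Rightarrow> 'v \<Rightarrow> 'v"
  where "rho_lam scale lam dg \<rho> x v = \<rho> (x + scale lam (dg x)) v"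

text \<open>
  The space of linear maps from the n-th exterior power of g to V, as the space of alternating
  n-linear maps. An n-tuple is a list of length n; cochains vanish on lists of any other length,
  so that equality of cochains is equality of functions. In degree 0 only the value at the
  empty list matters, which identifies the 0-cochains with V (lemmas below).
\<close>

definition cochains ::
  "('k::field \<Rightarrow> 'g::ab_group_add \<Rightarrow> 'g) \<Rightarrow> ('k \<Rightarrow> 'v::ab_group_add \<Rightarrow> 'v) \<Rightarrow>
   nat \<Rightarrow> ('g list \<Rightarrow> 'v) set"
  where "cochains scale scaleV n = {f.
    (\<forall>xs. length xs \<noteq> n \<longrightarrow> f xs = 0) \<and>
    (\<forall>xs i. length xs = n \<and> i < n \<longrightarrow>
       Vector_Spaces.linear scale scaleV (\<lambda>y. f (xs[i := y]))) \<and>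
    (\<forall>xs i j. length xs = n \<and> i < j \<and> j < n \<and> xs ! i = xs ! j \<longrightarrow> f xs = 0)}"

definition scale_cochain :: "('k \<Rightarrow> 'v \<Rightarrow> 'v) \<Rightarrow> 'k \<Rightarrow> ('g list \<Rightarrow> 'v) \<Rightarrow> 'g list \<Rightarrow> 'v"
  where "scale_cochain scaleV c f = (\<lambda>xs. scaleV c (f xs))"

text \<open>
  List positions start at 0, so the positions i, j below are the usual indices minus 1;
  this shifts the exponent of the first sign by one and does not affect the parity of the second.
\<close>

definition lie_coboundary ::
  "('g \<Rightarrow> 'g \<Rightarrow> 'g) \<Rightarrow> ('k::field \<Rightarrow> 'v::ab_group_add \<Rightarrow> 'v) \<Rightarrow> ('g \<Rightarrow> 'v \<Rightarrow> 'v) \<Rightarrow>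
   nat \<Rightarrow> ('g list \<Rightarrow> 'v) \<Rightarrow> 'g list \<Rightarrow> 'v"
  where "lie_coboundary bracket scaleV \<rho> n f xs =
    (if length xs = n + 1 then
       (\<Sum>i<n+1. scaleV ((-1) ^ (i + 1 + n)) (\<rho> (xs ! i) (f (nths xs (- {i}))))) +
       (\<Sum>(i, j) \<in> {(i, j). i < j \<and> j < n + 1}.
          scaleV ((-1) ^ (i + j + n + 1)) (f (bracket (xs ! i) (xs ! j) # nths xs (- {i, j}))))
     else 0)"

definition do_coboundary ::
  "('k::field \<Rightarrow> 'g::ab_group_add \<Rightarrow> 'g) \<Rightarrow> ('g \<Rightarrow> 'g \<Rightarrow> 'g) \<Rightarrow> 'k \<Rightarrow> ('g \<Rightarrow> 'g) \<Rightarrow>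
   ('k \<Rightarrow> 'v::ab_group_add \<Rightarrow> 'v) \<Rightarrow> ('g \<Rightarrow> 'v \<Rightarrow> 'v) \<Rightarrow>
   nat \<Rightarrow> ('g list \<Rightarrow> 'v) \<Rightarrow> 'g list \<Rightarrow> 'v"
  where "do_coboundary scale bracket lam dg scaleV \<rho> =
    lie_coboundary bracket scaleV (rho_lam scale lam dg \<rho>)"

definition apply_at :: "('g \<Rightarrow> 'g) \<Rightarrow> nat set \<Rightarrow> 'g list \<Rightarrow> 'g list"
  where "apply_at d I xs = map (\<lambda>i. if i \<in> I then d (xs ! i) else xs ! i) [0..<length xs]"

text \<open>
  A strictly increasing k-tuple of indices is encoded as the k-element set of its entries.
  In degree 0 the sum is empty, which leaves minus dV.
\<close>

definition delta ::
  "'k::field \<Rightarrow> ('g \<Rightarrow> 'g) \<Rightarrow> ('k \<Rightarrow> 'v::ab_group_add \<Rightarrow> 'v) \<Rightarrow> ('v \<Rightarrow> 'v) \<Rightarrow>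
   nat \<Rightarrow> ('g list \<Rightarrow> 'v) \<Rightarrow> 'g list \<Rightarrow> 'v"
  where "delta lam dg scaleV dV n f xs =
    (if length xs = n then
       (\<Sum>k=1..n. scaleV (lam ^ (k - 1))
          (\<Sum>I \<in> {I. I \<subseteq> {..<n} \<and> card I = k}. f (apply_at dg I xs)))
       - dV (f xs)
     else 0)"

definition linear_between ::
  "('k \<Rightarrow> 'a::ab_group_add \<Rightarrow> 'a) \<Rightarrow> ('k \<Rightarrow> 'b::ab_group_add \<Rightarrow> 'b) \<Rightarrow>
   'a set \<Rightarrow> 'b set \<Rightarrow> ('a \<Rightarrow> 'b) \<Rightarrow> bool"
  where "linear_between s t A B \<phi> \<longleftrightarrow>
    (\<forall>f\<in>A. \<phi> f \<in> B) \<and>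
    (\<forall>f\<in>A. \<forall>g\<in>A. \<phi> (f + g) = \<phi> f + \<phi> g) \<and>
    (\<forall>c. \<forall>f\<in>A. \<phi> (s c f) = t c (\<phi> f))"

definition cochain_complex ::
  "('k::field \<Rightarrow> 'a::ab_group_add \<Rightarrow> 'a) \<Rightarrow> (nat \<Rightarrow> 'a set) \<Rightarrow> (nat \<Rightarrow> 'a \<Rightarrow> 'a) \<Rightarrow> bool"
  where "cochain_complex s C d \<longleftrightarrow>
    vector_space s \<and>
    (\<forall>n. module.subspace s (C n)) \<and>
    (\<forall>n. linear_between s s (C n) (C (n + 1)) (d n)) \<and>
    (\<forall>n. \<forall>f\<in>C n. d (n + 1) (d n f) = 0)"

definition cochain_map ::
  "('k::field \<Rightarrow> 'a::ab_group_add \<Rightarrow> 'a) \<Rightarrow> (nat \<Rightarrow> 'a set) \<Rightarrow> (nat \<Rightarrow> 'a \<Rightarrow> 'a) \<Rightarrow>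
   ('k \<Rightarrow> 'b::ab_group_add \<Rightarrow> 'b) \<Rightarrow> (nat \<Rightarrow> 'b set) \<Rightarrow> (nat \<Rightarrow> 'b \<Rightarrow> 'b) \<Rightarrow>
   (nat \<Rightarrow> 'a \<Rightarrow> 'b) \<Rightarrow> bool"
  where "cochain_map s C d s' C' d' \<phi> \<longleftrightarrow>
    cochain_complex s C d \<and> cochain_complex s' C' d' \<and>
    (\<forall>n. linear_between s s' (C n) (C' n) (\<phi> n)) \<and>
    (\<forall>n. \<forall>f\<in>C n. d' n (\<phi> n f) = \<phi> (n + 1) (d n f))"

lemma cochains_0: "bij_betw (\<lambda>v xs. if xs = [] then v else 0) UNIV (cochains scale scaleV 0)"
  by (rule bij_betw_byWitness[where f' = "\<lambda>f. f []"]) (auto simp: cochains_def fun_eq_iff)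

lemma delta_0:
  "delta lam dg scaleV dV 0 (\<lambda>xs. if xs = [] then v else 0) =
   (\<lambda>xs. if xs = [] then - dV v else 0)"
  by (auto simp: delta_def fun_eq_iff)

end

theory Submission imports Defs begin

text \<open>
  Up to the sign \<open>(-1)^(n+1)\<close>, the coboundary \<open>d\<close> is determined by Cartan's formula
  \<open>\<iota>\<^sub>x d = L\<^sub>x - d \<iota>\<^sub>x\<close> with \<open>\<iota>\<^sub>x f = f(x, \<dots>)\<close>, which is a recursion on the list of arguments;
  likewise \<open>\<iota>\<^sub>y L\<^sub>x = L\<^sub>x \<iota>\<^sub>y - \<iota>\<^sub>[\<^sub>x\<^sub>,\<^sub>y\<^sub>]\<close>. Hence \<open>[L\<^sub>x, L\<^sub>y] = L\<^sub>[\<^sub>x\<^sub>,\<^sub>y\<^sub>]\<close>, \<open>d L\<^sub>x = L\<^sub>x d\<close> and \<open>d d = 0\<close>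
  follow by induction on that list.

  Write \<open>\<delta> = T - d\<^sub>V\<close> and \<open>D = 1 + \<lambda> d\<^sub>g\<close>, which is a Lie algebra endomorphism. Grouping the index sets in \<open>T\<close>
  by their largest element gives \<open>\<iota>\<^sub>x T f = \<iota>\<^sub>d\<^sub>x f + T \<iota>\<^sub>D\<^sub>x f\<close>, again a recursion. Neither \<open>T\<close> nor \<open>d\<^sub>V\<close> is
  a cochain map, but both fail by the same term \<open>R\<close>, the action part of \<open>d\<close> with \<open>\<rho>(x)\<close>
  replaced by \<open>\<rho>(d\<^sub>g x)\<close>: \<open>T d = R + d\<^sub>\<lambda> T\<close> and \<open>d\<^sub>V d = R + d\<^sub>\<lambda> d\<^sub>V\<close>.
\<close>

section \<open>The operators as recursions on the argument list\<close>

primrec lie_deriv ::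
  "('g \<Rightarrow> 'g \<Rightarrow> 'g) \<Rightarrow> ('g \<Rightarrow> 'v \<Rightarrow> 'v) \<Rightarrow> 'g \<Rightarrow> ('g list \<Rightarrow> 'v::ab_group_add) \<Rightarrow> 'g list \<Rightarrow> 'v"
  where
    "lie_deriv br \<rho> x f [] = \<rho> x (f [])"
  | "lie_deriv br \<rho> x f (y # ys) =
      lie_deriv br \<rho> x (\<lambda>zs. f (y # zs)) ys - f (br x y # ys)"

primrec ce_diff ::
  "('g \<Rightarrow> 'g \<Rightarrow> 'g) \<Rightarrow> ('g \<Rightarrow> 'v \<Rightarrow> 'v) \<Rightarrow> ('g list \<Rightarrow> 'v::ab_group_add) \<Rightarrow> 'g list \<Rightarrow> 'v"
  where
    "ce_diff br \<rho> f [] = 0"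
  | "ce_diff br \<rho> f (x # xs) = lie_deriv br \<rho> x f xs - ce_diff br \<rho> (\<lambda>zs. f (x # zs)) xs"

primrec ce_action ::
  "('g \<Rightarrow> 'v \<Rightarrow> 'v) \<Rightarrow> ('g list \<Rightarrow> 'v::ab_group_add) \<Rightarrow> 'g list \<Rightarrow> 'v"
  where
    "ce_action \<rho> f [] = 0"
  | "ce_action \<rho> f (x # xs) = \<rho> x (f xs) - ce_action \<rho> (\<lambda>zs. f (x # zs)) xs"

text \<open>
  This is \<open>f(dx\<^sub>1, x\<^sub>2, \<dots>) + f(Dx\<^sub>1, dx\<^sub>2, x\<^sub>3, \<dots>) + f(Dx\<^sub>1, Dx\<^sub>2, dx\<^sub>3, \<dots>) + \<dots>\<close>;
  for \<open>\<lambda> \<noteq> 0\<close> and \<open>D = 1 + \<lambda> d\<close> it is \<open>(f \<circ> D - f) / \<lambda>\<close>.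
\<close>

primrec telescope ::
  "('g \<Rightarrow> 'g) \<Rightarrow> ('g \<Rightarrow> 'g) \<Rightarrow> ('g list \<Rightarrow> 'v::ab_group_add) \<Rightarrow> 'g list \<Rightarrow> 'v"
  where
    "telescope D d f [] = 0"
  | "telescope D d f (x # xs) = f (d x # xs) + telescope D d (\<lambda>zs. f (D x # zs)) xs"

section \<open>Multilinear and alternating functions on lists\<close>

text \<open>The degree is not recorded: linearity and alternation are required on lists of every length.\<close>

definition multilinear ::
  "('k \<Rightarrow> 'g::ab_group_add \<Rightarrow> 'g) \<Rightarrow> ('k \<Rightarrow> 'v::ab_group_add \<Rightarrow> 'v) \<Rightarrow> ('g list \<Rightarrow> 'v) \<Rightarrow> bool"
  where "multilinear s t f \<longleftrightarrow>
    (\<forall>as bs x y. f (as @ (x + y) # bs) = f (as @ x # bs) + f (as @ y # bs)) \<and>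
    (\<forall>as bs c x. f (as @ s c x # bs) = t c (f (as @ x # bs)))"

definition alternating :: "('g list \<Rightarrow> 'v::zero) \<Rightarrow> bool"
  where "alternating f \<longleftrightarrow> (\<forall>as bs x. f (as @ x # x # bs) = 0)"

lemma multilinear_Cons: "multilinear s t f \<Longrightarrow> multilinear s t (\<lambda>zs. f (x # zs))"
  unfolding multilinear_def by (metis append_Cons)

lemma alternating_Cons: "alternating f \<Longrightarrow> alternating (\<lambda>zs. f (x # zs))"
  unfolding alternating_def by (metis append_Cons)

lemma multilinear_add_at:
  "multilinear s t f \<Longrightarrow> f (as @ (x + y) # bs) = f (as @ x # bs) + f (as @ y # bs)"
  by (simp add: multilinear_def)

lemma multilinear_scale_at:
  "multilinear s t f \<Longrightarrow> f (as @ s c x # bs) = t c (f (as @ x # bs))"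
  by (simp add: multilinear_def)

lemma multilinear_add:
  "multilinear s t f \<Longrightarrow> f ((x + y) # bs) = f (x # bs) + f (y # bs)"
  using multilinear_add_at[of s t f "[]"] by simp

lemma multilinear_scale: "multilinear s t f \<Longrightarrow> f (s c x # bs) = t c (f (x # bs))"
  using multilinear_scale_at[of s t f "[]"] by simp

lemma multilinear_zero:
  assumes "multilinear s t f" shows "f (as @ 0 # bs) = 0"
  using multilinear_add_at[OF assms, of as 0 0 bs] by simp

lemma multilinear_minus:
  assumes "multilinear s t f" shows "f (as @ (- x) # bs) = - f (as @ x # bs)"
  using multilinear_add_at[OF assms, of as x "- x" bs] multilinear_zero[OF assms, of as bs]
  by (simp add: eq_neg_iff_add_eq_0 add.commute)

lemma multilinear_diff:
  assumes "multilinear s t f" shows "f (as @ (x - y) # bs) = f (as @ x # bs) - f (as @ y # bs)"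
  using multilinear_add_at[OF assms, of as x "- y" bs] multilinear_minus[OF assms, of as y bs]
  by simp

lemma alternating_zero: "alternating f \<Longrightarrow> f (as @ x # x # bs) = 0"
  by (simp add: alternating_def)

text \<open>Polarization: the value at an adjacent pair of entries \<open>x + y\<close> is zero and
  expands into the two mixed terms.\<close>

lemma alternating_swap:
  assumes "multilinear s t f" "alternating f"
  shows "f (as @ x # y # bs) = - f (as @ y # x # bs)"
proof -
  have 1: "f (as @ u # (x + y) # bs) = f (as @ u # x # bs) + f (as @ u # y # bs)" for u
    using multilinear_add_at[OF assms(1), of "as @ [u]"] by simp
  have "0 = f (as @ (x + y) # (x + y) # bs)"
    using assms(2) by (simp add: alternating_zero)
  also have "\<dots> = f (as @ x # y # bs) + f (as @ y # x # bs)"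
    using assms(2) by (simp add: multilinear_add_at[OF assms(1)] 1 alternating_zero)
  finally show ?thesis by (simp add: eq_neg_iff_add_eq_0)
qed

lemma alternating_swap_front:
  "multilinear s t f \<Longrightarrow> alternating f \<Longrightarrow> f (x # y # bs) = - f (y # x # bs)"
  using alternating_swap[of s t f "[]" x y bs] by simp

text \<open>\<open>alternating\<close> speaks only of adjacent entries, \<open>cochains\<close> of
  any two positions. Swapping the first \<open>x\<close> past each entry of \<open>bs\<close> makes
  the two copies adjacent.\<close>

lemma alternating_repeat:
  assumes "multilinear s t f" "alternating f"
  shows "f (as @ x # bs @ x # cs) = 0"
proof (induction bs arbitrary: as)
  case Nil
  then show ?case using assms by (simp add: alternating_zero)
next
  case (Cons b bs)
  show ?case
    using alternating_swap[OF assms, of as x b "bs @ x # cs"] Cons.IH[of "as @ [b]"] by simp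
qed

section \<open>Identities in the Lie algebra\<close>

context lie_algebra
begin

lemma bracket_add_left: "bracket (x + y) z = bracket x z + bracket y z"
  using bracket_linear_left[of z] by (simp add: Vector_Spaces.linear_iff_module_hom module_hom_iff)

lemma bracket_add_right: "bracket z (x + y) = bracket z x + bracket z y"
  using bracket_linear_right[of z] by (simp add: Vector_Spaces.linear_iff_module_hom module_hom_iff)

lemma bracket_scale_left: "bracket (scale c x) z = scale c (bracket x z)"
  using bracket_linear_left[of z] by (simp add: Vector_Spaces.linear_iff_module_hom module_hom_iff)

lemma bracket_scale_right: "bracket z (scale c x) = scale c (bracket z x)"
  using bracket_linear_right[of z] by (simp add: Vector_Spaces.linear_iff_module_hom module_hom_iff)

lemma bracket_swap: "bracket x y = - bracket y x"
proof -
  have "bracket (x + y) (x + y) = bracket x y + bracket y x"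
    by (simp only: bracket_add_left) (simp add: bracket_add_right bracket_self)
  then show ?thesis by (simp add: bracket_self eq_neg_iff_add_eq_0)
qed

lemma bracket_neg_right: "bracket x (- y) = - bracket x y"
  using bracket_scale_right[of x "- 1" y] by simp

text \<open>The form of the Jacobi identity that makes the adjoint action a representation, as the
  commutator of Lie derivatives requires.\<close>

lemma jacobi_derivation: "bracket (bracket x y) z = bracket x (bracket y z) - bracket y (bracket x z)"
proof -
  have "bracket (bracket x y) z = - bracket z (bracket x y)" by (rule bracket_swap)
  moreover have "bracket y (bracket z x) = - bracket y (bracket x z)"
    by (metis bracket_swap bracket_neg_right)
  ultimately show ?thesis
    using jacobi[of x y z] by (metis (no_types) add.commute eq_neg_iff_add_eq_0 uminus_add_conv_diff minus_minus)
qed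

end

section \<open>Cartan calculus for the Lie derivative and the differential\<close>

context lie_representation
begin

lemmas multilinear_simps = multilinear_add[of scale scaleV] multilinear_scale[of scale scaleV]
  multilinear_add_at[of scale scaleV] multilinear_scale_at[of scale scaleV]
  multilinear_Cons[of scale scaleV]

lemma rho_add_left: "\<rho> (x + y) v = \<rho> x v + \<rho> y v"
  using rho_linear_left[of v] by (simp add: Vector_Spaces.linear_iff_module_hom module_hom_iff)

lemma rho_scale_left: "\<rho> (scale c x) v = scaleV c (\<rho> x v)"
  using rho_linear_left[of v] by (simp add: Vector_Spaces.linear_iff_module_hom module_hom_iff)

lemma rho_add: "\<rho> x (v + w) = \<rho> x v + \<rho> x w"
  using rho_linear_right[of x] by (simp add: Vector_Spaces.linear_iff_module_hom module_hom_iff)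

lemma rho_scale: "\<rho> x (scaleV c v) = scaleV c (\<rho> x v)"
  using rho_linear_right[of x] by (simp add: Vector_Spaces.linear_iff_module_hom module_hom_iff)

lemma rho_zero [simp]: "\<rho> x 0 = 0"
  using rho_add[of x 0 0] by simp

lemma rho_minus: "\<rho> x (- v) = - \<rho> x v"
  using rho_add[of x v "- v"] by (simp add: eq_neg_iff_add_eq_0 add.commute)

lemma rho_diff: "\<rho> x (v - w) = \<rho> x v - \<rho> x w"
  using rho_add[of x v "- w"] by (simp add: rho_minus)

abbreviation "L \<equiv> lie_deriv bracket \<rho>"
abbreviation "d \<equiv> ce_diff bracket \<rho>"

lemma lie_deriv_add: "L x (\<lambda>zs. f zs + g zs) xs = L x f xs + L x g xs"
  by (induction xs arbitrary: f g) (simp_all add: rho_add)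

lemma lie_deriv_diff: "L x (\<lambda>zs. f zs - g zs) xs = L x f xs - L x g xs"
  by (induction xs arbitrary: f g) (simp_all add: rho_diff)

lemma lie_deriv_zero: "L x (\<lambda>zs. 0) xs = 0"
  by (induction xs) simp_all

lemma lie_deriv_scale: "L x (\<lambda>zs. scaleV c (f zs)) xs = scaleV c (L x f xs)"
  by (induction xs arbitrary: f) (simp_all add: rho_scale V.scale_right_diff_distrib)

lemma ce_diff_add: "d (\<lambda>zs. f zs + g zs) xs = d f xs + d g xs"
  by (induction xs arbitrary: f g) (simp_all add: lie_deriv_add)

lemma ce_diff_diff: "d (\<lambda>zs. f zs - g zs) xs = d f xs - d g xs"
  by (induction xs arbitrary: f g) (simp_all add: lie_deriv_diff)

lemma ce_diff_zero: "d (\<lambda>zs. 0) xs = 0"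
  by (induction xs) (simp_all add: lie_deriv_zero)

lemma ce_diff_scale: "d (\<lambda>zs. scaleV c (f zs)) xs = scaleV c (d f xs)"
  by (induction xs arbitrary: f) (simp_all add: lie_deriv_scale V.scale_right_diff_distrib)

lemma lie_deriv_add_left: "multilinear scale scaleV f \<Longrightarrow> L (x + y) f xs = L x f xs + L y f xs"
  by (induction xs arbitrary: f)
    (simp_all add: rho_add_left bracket_add_left multilinear_simps)

lemma lie_deriv_scale_left: "multilinear scale scaleV f \<Longrightarrow> L (scale c x) f xs = scaleV c (L x f xs)"
  by (induction xs arbitrary: f)
    (simp_all add: rho_scale_left bracket_scale_left multilinear_simps V.scale_right_diff_distrib)

text \<open>The recursion strips the prefix \<open>as\<close>. Once the varied entry comes first,
  linearity of \<open>L x\<close> in the function and of \<open>bracket x\<close> applies.\<close>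

lemma multilinear_lie_deriv:
  assumes "multilinear scale scaleV f"
  shows "multilinear scale scaleV (L x f)"
proof -
  have "L x f (as @ (y + z) # bs) = L x f (as @ y # bs) + L x f (as @ z # bs)" for as bs y z
    using assms
  proof (induction as arbitrary: f)
    case Nil
    then show ?case by (simp add: multilinear_simps bracket_add_right lie_deriv_add)
  next
    case (Cons a as)
    have "f (bracket x a # as @ (y + z) # bs) = f (bracket x a # as @ y # bs) + f (bracket x a # as @ z # bs)"
      using multilinear_add_at[OF Cons.prems, of "bracket x a # as"] by simp
    then show ?case using Cons.IH[OF multilinear_Cons[OF Cons.prems]] by simp
  qed
  moreover have "L x f (as @ scale c y # bs) = scaleV c (L x f (as @ y # bs))" for as bs c y
    using assms
  proof (induction as arbitrary: f)
    case Nil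
    then show ?case
      by (simp add: multilinear_simps bracket_scale_right lie_deriv_scale V.scale_right_diff_distrib)
  next
    case (Cons a as)
    have "f (bracket x a # as @ scale c y # bs) = scaleV c (f (bracket x a # as @ y # bs))"
      using multilinear_scale_at[OF Cons.prems, of "bracket x a # as"] by simp
    then show ?case
      using Cons.IH[OF multilinear_Cons[OF Cons.prems]] by (simp add: V.scale_right_diff_distrib)
  qed
  ultimately show ?thesis by (simp add: multilinear_def)
qed

text \<open>With the equal entries in front, the two terms in which \<open>bracket x\<close> hits
  one of them cancel by antisymmetry; the rest is \<open>L x\<close> of a zero function.\<close>

lemma alternating_lie_deriv:
  assumes "multilinear scale scaleV f" "alternating f"
  shows "alternating (L x f)"
proof -
  have "L x f (as @ y # y # bs) = 0" for as bs y
    using assms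
  proof (induction as arbitrary: f)
    case Nil
    have "f (y # y # zs) = 0" for zs
      using alternating_zero[OF Nil.prems(2), of "[]"] by simp
    then show ?case
      using alternating_swap_front[OF Nil.prems, of y "bracket x y" bs] by (simp add: lie_deriv_zero)
  next
    case (Cons a as)
    have "f (bracket x a # as @ y # y # bs) = 0"
      using alternating_zero[OF Cons.prems(2), of "bracket x a # as"] by simp
    then show ?case
      using Cons.IH[OF multilinear_Cons[OF Cons.prems(1)] alternating_Cons[OF Cons.prems(2)]] by simp
  qed
  then show ?thesis by (simp add: alternating_def)
qed

lemma multilinear_ce_diff:
  assumes "multilinear scale scaleV f"
  shows "multilinear scale scaleV (d f)"
proof -
  have "d f (as @ (y + z) # bs) = d f (as @ y # bs) + d f (as @ z # bs)" for as bs y z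
    using assms
  proof (induction as arbitrary: f)
    case Nil
    then show ?case by (simp add: multilinear_simps lie_deriv_add_left ce_diff_add)
  next
    case (Cons a as)
    then show ?case
      using multilinear_add_at[OF multilinear_lie_deriv[OF Cons.prems]]
        Cons.IH[OF multilinear_Cons[OF Cons.prems]] by simp
  qed
  moreover have "d f (as @ scale c y # bs) = scaleV c (d f (as @ y # bs))" for as bs c y
    using assms
  proof (induction as arbitrary: f)
    case Nil
    then show ?case
      by (simp add: multilinear_simps lie_deriv_scale_left ce_diff_scale V.scale_right_diff_distrib)
  next
    case (Cons a as)
    then show ?case
      using multilinear_scale_at[OF multilinear_lie_deriv[OF Cons.prems]]
        Cons.IH[OF multilinear_Cons[OF Cons.prems]] by (simp add: V.scale_right_diff_distrib)
  qed
  ultimately show ?thesis by (simp add: multilinear_def)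
qed

text \<open>With equal entries \<open>y\<close> in front, the two occurrences of \<open>L y\<close>
  cancel; what remains contains \<open>bracket y y\<close> or \<open>f(y, y, ...)\<close>.\<close>

lemma alternating_ce_diff:
  assumes "multilinear scale scaleV f" "alternating f"
  shows "alternating (d f)"
proof -
  have "d f (as @ y # y # bs) = 0" for as bs y
    using assms
  proof (induction as arbitrary: f)
    case Nil
    have "f (y # y # zs) = 0" for zs
      using alternating_zero[OF Nil.prems(2), of "[]"] by simp
    then show ?case
      using multilinear_zero[OF Nil.prems(1), of "[]"] by (simp add: ce_diff_zero bracket_self)
  next
    case (Cons a as)
    then show ?case
      using alternating_zero[OF alternating_lie_deriv[OF Cons.prems]]
        Cons.IH[OF multilinear_Cons[OF Cons.prems(1)] alternating_Cons[OF Cons.prems(2)]] by simp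
  qed
  then show ?thesis by (simp add: alternating_def)
qed

text \<open>At the empty list this is \<open>rho_bracket\<close>. In the induction step the terms
  with one bracket and one Lie derivative cancel, and the double brackets combine by
  \<open>jacobi_derivation\<close>.\<close>

lemma lie_deriv_commutator:
  assumes "multilinear scale scaleV f"
  shows "L x (L y f) xs - L y (L x f) xs = L (bracket x y) f xs"
  using assms
proof (induction xs arbitrary: f)
  case Nil
  then show ?case by (simp add: rho_bracket)
next
  case (Cons z zs)
  have "f (bracket (bracket x y) z # zs) = f (bracket x (bracket y z) # zs) - f (bracket y (bracket x z) # zs)"
    using multilinear_diff[OF Cons.prems, of "[]"] by (simp add: jacobi_derivation)
  then show ?case
    using Cons.IH[OF multilinear_Cons[OF Cons.prems], of z] by (simp add: lie_deriv_diff algebra_simps)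
qed

text \<open>At \<open>y # ys\<close> both sides contain \<open>d\<close> of
  \<open>f([x, y], ...)\<close>. The induction hypothesis for \<open>f(y, ...)\<close> and the
  commutator of \<open>L x\<close> and \<open>L y\<close> match the rest.\<close>

lemma ce_diff_lie_deriv:
  assumes "multilinear scale scaleV f"
  shows "d (L x f) ys = L x (d f) ys"
  using assms
proof (induction ys arbitrary: f)
  case Nil
  then show ?case by simp
next
  case (Cons y ys)
  then show ?case
    using Cons.IH[OF multilinear_Cons[OF Cons.prems], of y] lie_deriv_commutator[OF Cons.prems, of x y ys]
    by (simp add: lie_deriv_diff ce_diff_diff algebra_simps)
qed

text \<open>Cartan's formula turns \<open>d (d f)\<close> with first argument \<open>x\<close> into
  the commutator of \<open>L x\<close> and \<open>d\<close>, which vanishes, plus \<open>d d\<close>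
  of \<open>f(x, ...)\<close>.\<close>

lemma ce_diff_ce_diff:
  assumes "multilinear scale scaleV f"
  shows "d (d f) xs = 0"
  using assms
proof (induction xs arbitrary: f)
  case Nil
  then show ?case by simp
next
  case (Cons x xs)
  then show ?case
    using Cons.IH[OF multilinear_Cons[OF Cons.prems], of x]
    by (simp add: ce_diff_diff ce_diff_lie_deriv)
qed

end

section \<open>Index sets split at the head of the list, and cochains as functions on lists\<close>

lemma nths_Cons_compl:
  "nths (x # xs) (- {0}) = xs"
  "nths (x # xs) (- {Suc i}) = x # nths xs (- {i})"
  "nths (x # xs) (- {0, Suc i}) = nths xs (- {i})"
  "nths (x # xs) (- {Suc i, Suc j}) = x # nths xs (- {i, j})"
proof -
  have "{k. Suc k \<in> - {0}} = UNIV" "{k. Suc k \<in> - {Suc i}} = - {i}"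
    "{k. Suc k \<in> - {0, Suc i}} = - {i}" "{k. Suc k \<in> - {Suc i, Suc j}} = - {i, j}"
    by auto
  then show "nths (x # xs) (- {0}) = xs"
    "nths (x # xs) (- {Suc i}) = x # nths xs (- {i})"
    "nths (x # xs) (- {0, Suc i}) = nths xs (- {i})"
    "nths (x # xs) (- {Suc i, Suc j}) = x # nths xs (- {i, j})"
    by (simp_all add: nths_Cons nths_all)
qed

text \<open>Pairs with first index 0 involve the head of the list, the others only its tail: the
  counterpart of one step of \<open>ce_diff\<close>.\<close>

lemma sum_pairs_Suc:
  fixes h :: "nat \<times> nat \<Rightarrow> 'a::comm_monoid_add"
  shows "(\<Sum>p \<in> {(i, j). i < j \<and> j < Suc m}. h p) =
    (\<Sum>j<m. h (0, Suc j)) + (\<Sum>(i, j) \<in> {(i, j). i < j \<and> j < m}. h (Suc i, Suc j))"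
proof -
  let ?A = "(\<lambda>j. (0, Suc j)) ` {..<m}" and ?P = "{(i, j). i < j \<and> j < m}"
  let ?B = "map_prod Suc Suc ` ?P"
  have fin: "finite ?P" by (rule finite_subset[of _ "{..<m} \<times> {..<m}"]) auto
  have "(i, j) \<in> ?A \<union> ?B" if "i < j" "j < Suc m" for i j
    using that by (cases i; cases j) (auto simp: image_iff)
  then have eq: "{(i, j). i < j \<and> j < Suc m} = ?A \<union> ?B" by auto
  have "sum h (?A \<union> ?B) = sum h ?A + sum h ?B"
    using fin by (intro sum.union_disjoint) auto
  also have "sum h ?A = (\<Sum>j<m. h (0, Suc j))"
    by (subst sum.reindex) (auto simp: inj_on_def)
  also have "sum h ?B = (\<Sum>(i, j) \<in> ?P. h (Suc i, Suc j))"
    by (subst sum.reindex) (auto simp: inj_on_def intro!: sum.cong)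
  finally show ?thesis unfolding eq .
qed

text \<open>A set is determined by whether it contains 0 and by its shifted remainder
  \<open>J\<close>; an empty remainder leaves only \<open>{0}\<close>. This matches one step of
  \<open>telescope\<close>.\<close>

lemma sum_nonempty_subsets_Suc:
  fixes h :: "nat set \<Rightarrow> 'a::comm_monoid_add"
  shows "sum h (Pow {..<Suc n} - {{}}) =
    h {0} + (\<Sum>J \<in> Pow {..<n} - {{}}. h (Suc ` J) + h (insert 0 (Suc ` J)))"
proof -
  let ?N = "Pow {..<n} - {{}}"
  let ?A = "(`) Suc ` ?N" and ?B = "(\<lambda>J. insert 0 (Suc ` J)) ` ?N"
  have mem: "I \<in> insert {0} (?A \<union> ?B)" if I: "I \<subseteq> {..<Suc n}" "I \<noteq> {}" for I
  proof -
    define J where "J = {j. Suc j \<in> I}"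
    have J: "J \<subseteq> {..<n}" using I by (auto simp: J_def)
    have "I = (if 0 \<in> I then insert 0 (Suc ` J) else Suc ` J)"
    proof (rule set_eqI)
      fix k show "k \<in> I \<longleftrightarrow> k \<in> (if 0 \<in> I then insert 0 (Suc ` J) else Suc ` J)"
        by (cases k) (auto simp: J_def)
    qed
    then show ?thesis using J I by (cases "J = {}") (auto split: if_splits)
  qed
  have eq: "Pow {..<Suc n} - {{}} = insert {0} (?A \<union> ?B)"
  proof
    show "Pow {..<Suc n} - {{}} \<subseteq> insert {0} (?A \<union> ?B)" using mem by blast
  qed auto
  have inj: "inj_on (\<lambda>J. insert 0 (Suc ` J)) ?N"
  proof (rule inj_onI)
    fix J K assume *: "insert 0 (Suc ` J) = insert 0 (Suc ` K)"
    have "Suc ` J = Suc ` K" using arg_cong[OF *, of "\<lambda>S. S - {0}"] by auto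
    then show "J = K" by (simp add: inj_image_eq_iff)
  qed
  have "sum h (insert {0} (?A \<union> ?B)) = h {0} + sum h (?A \<union> ?B)"
  proof (rule sum.insert)
    show "{0} \<notin> ?A \<union> ?B"
    proof
      assume "{0} \<in> ?A \<union> ?B"
      then obtain J j where "j \<in> J" "Suc ` J \<subseteq> {0}" by blast
      then show False by blast
    qed
  qed simp
  also have "sum h (?A \<union> ?B) = sum h ?A + sum h ?B"
  proof (rule sum.union_disjoint)
    show "?A \<inter> ?B = {}" by blast
  qed simp_all
  also have "sum h ?A = (\<Sum>J\<in>?N. h (Suc ` J))"
    by (subst sum.reindex) (auto simp: inj_on_def inj_image_eq_iff)
  also have "sum h ?B = (\<Sum>J\<in>?N. h (insert 0 (Suc ` J)))"
    using inj by (subst sum.reindex) auto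
  finally show ?thesis unfolding eq by (simp add: sum.distrib)
qed

lemma apply_at_Cons:
  "apply_at d I (x # xs) = (if 0 \<in> I then d x else x) # apply_at d {j. Suc j \<in> I} xs"
  by (simp add: apply_at_def upt_conv_Cons map_Suc_upt[symmetric] del: upt_Suc)

lemma apply_at_empty: "apply_at d {} xs = xs"
  by (simp add: apply_at_def map_nth)

text \<open>Cochains vanish off degree \<open>n\<close>, so the length-free conditions are trivial
  on all other lists. This replaces list positions by the append form that suits the
  recursions.\<close>

lemma cochains_iff:
  assumes "vector_space scale" "vector_space scaleV"
  shows "f \<in> cochains scale scaleV n \<longleftrightarrow>
    multilinear scale scaleV f \<and> alternating f \<and> (\<forall>xs. length xs \<noteq> n \<longrightarrow> f xs = 0)"
    (is "_ \<longleftrightarrow> ?R")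
proof
  assume f: "f \<in> cochains scale scaleV n"
  have supp: "f xs = 0" if "length xs \<noteq> n" for xs
    using f that unfolding cochains_def by blast
  have upd: "Vector_Spaces.linear scale scaleV (\<lambda>y. f (xs[i := y]))" if "length xs = n" "i < n" for xs i
    using f that unfolding cochains_def by blast
  have alt: "f xs = 0" if "length xs = n" "i < j" "j < n" "xs ! i = xs ! j" for xs i j
    using f that unfolding cochains_def by blast
  have lin: "Vector_Spaces.linear scale scaleV (\<lambda>y. f (as @ y # bs))" if "length (as @ 0 # bs) = n" for as bs
    using upd[OF that, of "length as"] that by simp
  interpret V: vector_space scaleV by fact
  have "f (as @ (x + y) # bs) = f (as @ x # bs) + f (as @ y # bs)
      \<and> f (as @ scale c x # bs) = scaleV c (f (as @ x # bs))" for as bs x y c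
    using lin[of as bs] supp
    by (cases "length (as @ 0 # bs) = n") (auto simp: Vector_Spaces.linear_iff_module_hom module_hom_iff)
  moreover have "f (as @ x # x # bs) = 0" for as bs x
  proof (cases "length (as @ x # x # bs) = n")
    case True
    then show ?thesis
      by (intro alt[of _ "length as" "Suc (length as)"]) (auto simp: nth_append)
  qed (rule supp)
  ultimately show ?R using supp by (auto simp: multilinear_def alternating_def)
next
  assume R: ?R
  have "Vector_Spaces.linear scale scaleV (\<lambda>y. f (xs[i := y]))" if "i < length xs" for xs i
    using R that assms
    by (simp add: upd_conv_take_nth_drop multilinear_def Vector_Spaces.linear_iff_module_hom
        module_hom_iff module_iff_vector_space)
  moreover have "f xs = 0" if "i < j" "j < length xs" "xs ! i = xs ! j" for xs i j
  proof -
    \<comment> \<open>Splitting \<open>xs\<close> at \<open>i\<close>, then the remainder at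
      \<open>j\<close>, exposes both equal entries in the form of
      \<open>alternating_repeat\<close>.\<close>
    define ys where "ys = drop (Suc i) xs"
    have "xs = take i xs @ xs ! i # ys"
      using that id_take_nth_drop[of i xs] by (simp add: ys_def)
    moreover have "ys = take (j - Suc i) ys @ xs ! j # drop (Suc (j - Suc i)) ys"
      using that id_take_nth_drop[of "j - Suc i" ys] by (simp add: ys_def)
    ultimately have "xs = take i xs @ xs ! i # take (j - Suc i) ys @ xs ! i # drop (Suc (j - Suc i)) ys"
      using that by simp
    then show ?thesis using alternating_repeat R by metis
  qed
  ultimately show "f \<in> cochains scale scaleV n" using R by (auto simp: cochains_def)
qed

section \<open>The Chevalley-Eilenberg complex\<close>

context lie_representation
begin

lemma vector_space_cochain: "vector_space (scale_cochain scaleV)"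
  by unfold_locales
    (simp_all add: scale_cochain_def fun_eq_iff V.scale_right_distrib V.scale_left_distrib)

lemma subspace_cochains: "module.subspace (scale_cochain scaleV) (cochains scale scaleV n)"
proof -
  interpret C: vector_space "scale_cochain scaleV" by (rule vector_space_cochain)
  show ?thesis
    by (simp add: C.subspace_def cochains_iff[OF vector_space_axioms V.vector_space_axioms]
        multilinear_def alternating_def scale_cochain_def V.scale_right_distrib V.scale_left_commute
        add.commute add.left_commute)
qed

text \<open>
  The operators only read \<open>f\<close> on lists of one length, so cochains keep vanishing off their degree.
\<close>

lemma lie_deriv_local: "(\<And>zs. length zs = length xs \<Longrightarrow> f zs = 0) \<Longrightarrow> L x f xs = 0"
  by (induction xs arbitrary: f) simp_all

lemma ce_diff_local: "(\<And>zs. Suc (length zs) = length xs \<Longrightarrow> f zs = 0) \<Longrightarrow> d f xs = 0"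
  by (induction xs arbitrary: f) (simp_all add: lie_deriv_local)

text \<open>The classical formula for the Lie derivative; it supplies the brackets of the head with
  the tail entries in \<open>ce_diff_sum\<close>.\<close>

lemma lie_deriv_sum: "L x f xs = \<rho> x (f xs) - (\<Sum>k<length xs. f (xs[k := bracket x (xs ! k)]))"
  by (induction xs arbitrary: f) (simp_all add: sum.lessThan_Suc_shift del: sum.lessThan_Suc)

text \<open>This takes \<open>k\<close> adjacent transpositions: the induction hypothesis brings
  \<open>z\<close> just behind the head \<open>y\<close>, and one more swap passes
  \<open>y\<close>.\<close>

lemma alternating_to_front:
  assumes "multilinear scale scaleV f" "alternating f" "k < length xs"
  shows "f (xs[k := z]) = scaleV ((- 1) ^ k) (f (z # nths xs (- {k})))"
  using assms
proof (induction xs arbitrary: f k)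
  case Nil
  then show ?case by simp
next
  case (Cons y ys)
  show ?case
  proof (cases k)
    case 0
    then show ?thesis by (simp add: nths_Cons_compl)
  next
    case (Suc j)
    have "f (y # ys[j := z]) = scaleV ((- 1) ^ j) (f (y # z # nths ys (- {j})))"
      using Cons.prems(3) Suc
      by (intro Cons.IH[OF multilinear_Cons[OF Cons.prems(1)] alternating_Cons[OF Cons.prems(2)]]) simp
    moreover have "f (y # z # nths ys (- {j})) = - f (z # y # nths ys (- {j}))"
      by (rule alternating_swap_front[OF Cons.prems(1,2)])
    ultimately show ?thesis
      unfolding Suc by (simp only: list_update.simps nat.case nths_Cons_compl) simp
  qed
qed

text \<open>The head gives the action term for index 0 and the pairs \<open>(0, j)\<close>. For the
  tail, the minus sign in \<open>ce_diff\<close> is the index shift in the action sum; in the pair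
  sum, where \<open>i + j\<close> grows by two, it is cancelled by swapping \<open>x\<close> past
  the bracket.\<close>

lemma ce_diff_sum:
  assumes "multilinear scale scaleV f" "alternating f"
  shows "d f xs =
    (\<Sum>i<length xs. scaleV ((- 1) ^ i) (\<rho> (xs ! i) (f (nths xs (- {i}))))) +
    (\<Sum>(i, j) \<in> {(i, j). i < j \<and> j < length xs}.
      scaleV ((- 1) ^ (i + j)) (f (bracket (xs ! i) (xs ! j) # nths xs (- {i, j}))))"
  using assms
proof (induction xs arbitrary: f)
  case Nil
  then show ?case by simp
next
  case (Cons x xs)
  let ?g = "\<lambda>i j. f (bracket (xs ! i) (xs ! j) # x # nths xs (- {i, j}))"
  have swap: "f (x # bracket u v # zs) = - f (bracket u v # x # zs)" for u v zs
    by (rule alternating_swap_front[OF Cons.prems])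
  have "(\<Sum>k<length xs. f (xs[k := bracket x (xs ! k)])) =
      (\<Sum>k<length xs. scaleV ((- 1) ^ k) (f (bracket x (xs ! k) # nths xs (- {k}))))"
    using Cons.prems by (intro sum.cong) (simp_all add: alternating_to_front)
  then have "L x f xs = \<rho> x (f xs) -
      (\<Sum>k<length xs. scaleV ((- 1) ^ k) (f (bracket x (xs ! k) # nths xs (- {k}))))"
    by (simp add: lie_deriv_sum)
  moreover have "d (\<lambda>zs. f (x # zs)) xs =
      (\<Sum>i<length xs. scaleV ((- 1) ^ i) (\<rho> (xs ! i) (f (x # nths xs (- {i}))))) -
      (\<Sum>(i, j) \<in> {(i, j). i < j \<and> j < length xs}. scaleV ((- 1) ^ (i + j)) (?g i j))"
    using Cons.IH[OF multilinear_Cons[OF Cons.prems(1)] alternating_Cons[OF Cons.prems(2)], of x]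
    by (simp add: swap case_prod_unfold sum_negf)
  moreover have pairs: "(\<Sum>(i, j) \<in> {(i, j). i < j \<and> j < Suc (length xs)}.
        scaleV ((- 1) ^ (i + j)) (f (bracket ((x # xs) ! i) ((x # xs) ! j) # nths (x # xs) (- {i, j})))) =
      (\<Sum>(i, j) \<in> {(i, j). i < j \<and> j < length xs}. scaleV ((- 1) ^ (i + j)) (?g i j)) -
      (\<Sum>k<length xs. scaleV ((- 1) ^ k) (f (bracket x (xs ! k) # nths xs (- {k}))))"
    by (subst sum_pairs_Suc) (simp add: nths_Cons_compl sum_negf)
  ultimately show ?case
    unfolding length_Cons pairs sum.lessThan_Suc_shift
    by (simp add: nths_Cons_compl sum_negf)
qed

text \<open>The signs of the explicit formula are those of \<open>ce_diff_sum\<close> times a global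
  one. Through this identity the facts about \<open>d\<close> pass to
  \<open>lie_coboundary\<close>.\<close>

lemma lie_coboundary_eq:
  assumes "f \<in> cochains scale scaleV n"
  shows "lie_coboundary bracket scaleV \<rho> n f = (\<lambda>xs. scaleV ((- 1) ^ (n + 1)) (d f xs))"
proof
  fix xs
  have f: "multilinear scale scaleV f" "alternating f" "\<And>zs. length zs \<noteq> n \<Longrightarrow> f zs = 0"
    using assms by (auto simp: cochains_iff[OF vector_space_axioms V.vector_space_axioms])
  show "lie_coboundary bracket scaleV \<rho> n f xs = scaleV ((- 1) ^ (n + 1)) (d f xs)"
  proof (cases "length xs = n + 1")
    case True
    have sg: "(- 1) ^ (i + n) = (- 1) ^ n * (- 1 :: 'k) ^ i" for i by (simp add: power_add)
    show ?thesis using True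
      by (simp add: lie_coboundary_def ce_diff_sum[OF f(1,2)] V.scale_right_distrib V.scale_sum_right
          case_prod_unfold sg sum_negf mult.commute)
  next
    case False
    then show ?thesis
      using f(3) by (auto simp: lie_coboundary_def intro!: ce_diff_local)
  qed
qed

lemma lie_coboundary_in_cochains:
  assumes "f \<in> cochains scale scaleV n"
  shows "lie_coboundary bracket scaleV \<rho> n f \<in> cochains scale scaleV (n + 1)"
proof -
  interpret C: vector_space "scale_cochain scaleV" by (rule vector_space_cochain)
  have f: "multilinear scale scaleV f" "alternating f" "\<And>zs. length zs \<noteq> n \<Longrightarrow> f zs = 0"
    using assms by (auto simp: cochains_iff[OF vector_space_axioms V.vector_space_axioms])
  have "d f \<in> cochains scale scaleV (n + 1)"
    using f multilinear_ce_diff[OF f(1)] alternating_ce_diff[OF f(1,2)]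
    by (auto simp: cochains_iff[OF vector_space_axioms V.vector_space_axioms] intro!: ce_diff_local)
  then have "scale_cochain scaleV ((- 1) ^ (n + 1)) (d f) \<in> cochains scale scaleV (n + 1)"
    by (rule C.subspace_scale[OF subspace_cochains])
  then show ?thesis by (simp only: lie_coboundary_eq[OF assms] scale_cochain_def)
qed

lemma cochain_complex_lie_coboundary:
  "cochain_complex (scale_cochain scaleV) (cochains scale scaleV) (lie_coboundary bracket scaleV \<rho>)"
proof -
  interpret C: vector_space "scale_cochain scaleV" by (rule vector_space_cochain)
  have "linear_between (scale_cochain scaleV) (scale_cochain scaleV)
      (cochains scale scaleV n) (cochains scale scaleV (n + 1)) (lie_coboundary bracket scaleV \<rho> n)" for n
  proof -
    have "lie_coboundary bracket scaleV \<rho> n (f + g) =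
        lie_coboundary bracket scaleV \<rho> n f + lie_coboundary bracket scaleV \<rho> n g"
      if "f \<in> cochains scale scaleV n" "g \<in> cochains scale scaleV n" for f g
      using that C.subspace_add[OF subspace_cochains that]
      by (simp add: lie_coboundary_eq plus_fun_def ce_diff_add V.scale_right_distrib)
    moreover have "lie_coboundary bracket scaleV \<rho> n (scale_cochain scaleV c f) =
        scale_cochain scaleV c (lie_coboundary bracket scaleV \<rho> n f)"
      if "f \<in> cochains scale scaleV n" for c f
      using that C.subspace_scale[OF subspace_cochains that, of c]
      by (simp add: lie_coboundary_eq scale_cochain_def ce_diff_scale mult.commute)
    ultimately show ?thesis
      using lie_coboundary_in_cochains by (simp add: linear_between_def)
  qed
  moreover have "lie_coboundary bracket scaleV \<rho> (n + 1) (lie_coboundary bracket scaleV \<rho> n f) = 0"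
    if "f \<in> cochains scale scaleV n" for n f
  proof -
    have "multilinear scale scaleV f"
      using that by (simp add: cochains_iff[OF vector_space_axioms V.vector_space_axioms])
    then show ?thesis
      \<comment> \<open>The outer coboundary goes first: its equation mentions the inner one in
        unexpanded form.\<close>
      unfolding lie_coboundary_eq[OF lie_coboundary_in_cochains[OF that]]
      unfolding lie_coboundary_eq[OF that] ce_diff_scale
      by (simp add: ce_diff_ce_diff fun_eq_iff)
  qed
  ultimately show ?thesis
    using vector_space_cochain subspace_cochains by (simp add: cochain_complex_def)
qed

end

section \<open>The endomorphism \<open>shift\<close> and the twisted representation\<close>

context differential_representation
begin

definition shift :: "'g \<Rightarrow> 'g" where "shift x = x + scale lam (dg x)"

abbreviation "\<rho>' \<equiv> rho_lam scale lam dg \<rho>"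
abbreviation "L' \<equiv> lie_deriv bracket \<rho>'"
abbreviation "d' \<equiv> ce_diff bracket \<rho>'"
abbreviation "R \<equiv> ce_action (\<lambda>x. \<rho> (dg x))"
abbreviation "T \<equiv> telescope shift dg"

lemma dg_add: "dg (x + y) = dg x + dg y"
  using dg_linear by (simp add: Vector_Spaces.linear_iff_module_hom module_hom_iff)

lemma dg_scale: "dg (scale c x) = scale c (dg x)"
  using dg_linear by (simp add: Vector_Spaces.linear_iff_module_hom module_hom_iff)

lemma dV_add: "dV (v + w) = dV v + dV w"
  using dV_linear by (simp add: Vector_Spaces.linear_iff_module_hom module_hom_iff)

lemma dV_scale: "dV (scaleV c v) = scaleV c (dV v)"
  using dV_linear by (simp add: Vector_Spaces.linear_iff_module_hom module_hom_iff)

lemma dV_zero [simp]: "dV 0 = 0"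
  using dV_scale[of 0 0] by simp

lemma dV_diff: "dV (v - w) = dV v - dV w"
  using dV_add[of "v - w" w] by simp

lemma shift_add: "shift (x + y) = shift x + shift y"
  by (simp add: shift_def dg_add scale_right_distrib)

lemma shift_scale: "shift (scale c x) = scale c (shift x)"
  by (simp add: shift_def dg_scale scale_right_distrib mult.commute)

text \<open>Beyond \<open>bracket x y\<close>, the expanded left side is \<open>lam\<close> times
  the weighted Leibniz rule for \<open>dg\<close>.\<close>

lemma bracket_shift: "bracket (shift x) (shift y) = shift (bracket x y)"
  by (simp add: shift_def dg_bracket bracket_add_left bracket_add_right bracket_scale_left
      bracket_scale_right scale_right_distrib add_ac)

lemma rho_lam_shift: "\<rho>' x v = \<rho> (shift x) v"
  by (simp add: rho_lam_def shift_def)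

lemma rho_lam_expand: "\<rho>' x v = \<rho> x v + scaleV lam (\<rho> (dg x) v)"
  by (simp add: rho_lam_def rho_add_left rho_scale_left)

text \<open>\<open>\<rho>'\<close> is \<open>\<rho>\<close> pulled back along the endomorphism
  \<open>shift\<close>. The locale can thus be interpreted again, giving the target complex the same
  calculus.\<close>

lemma rho_lam_representation: "lie_representation scale bracket scaleV \<rho>'"
proof (intro lie_representation.intro lie_representation_axioms.intro)
  show "Vector_Spaces.linear scale scaleV (\<lambda>x. \<rho>' x v)" for v
    by (simp add: Vector_Spaces.linear_iff_module_hom module_hom_iff module_axioms V.module_axioms
        rho_lam_shift shift_add shift_scale rho_add_left rho_scale_left)
  show "Vector_Spaces.linear scaleV scaleV (\<rho>' x)" for x
    by (simp add: Vector_Spaces.linear_iff_module_hom module_hom_iff V.module_axioms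
        rho_lam_shift rho_add rho_scale)
  show "\<rho>' (bracket x y) v = \<rho>' x (\<rho>' y v) - \<rho>' y (\<rho>' x v)" for x y v
    by (simp add: rho_lam_shift rho_bracket flip: bracket_shift)
qed (rule lie_algebra_axioms V.vector_space_axioms)+

interpretation lam: lie_representation scale bracket scaleV \<rho>'
  by (rule rho_lam_representation)

section \<open>The operator \<open>T\<close> on multilinear and alternating functions\<close>

lemma multilinear_shift:
  "multilinear scale scaleV f \<Longrightarrow> f (shift x # xs) = f (x # xs) + scaleV lam (f (dg x # xs))"
  by (simp add: shift_def multilinear_simps)

lemma telescope_add: "T (\<lambda>zs. f zs + g zs) xs = T f xs + T g xs"
  by (induction xs arbitrary: f g) simp_all

lemma telescope_diff: "T (\<lambda>zs. f zs - g zs) xs = T f xs - T g xs"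
  by (induction xs arbitrary: f g) simp_all

lemma telescope_scale: "T (\<lambda>zs. scaleV c (f zs)) xs = scaleV c (T f xs)"
  by (induction xs arbitrary: f) (simp_all add: V.scale_right_distrib)

lemma telescope_zero: "T (\<lambda>zs. 0) xs = 0"
  by (induction xs) simp_all

lemma telescope_local: "(\<And>zs. length zs = length xs \<Longrightarrow> f zs = 0) \<Longrightarrow> T f xs = 0"
  by (induction xs arbitrary: f) simp_all

lemma ce_action_add: "R (\<lambda>zs. f zs + g zs) xs = R f xs + R g xs"
  by (induction xs arbitrary: f g) (simp_all add: rho_add)

lemma ce_action_scale: "R (\<lambda>zs. scaleV c (f zs)) xs = scaleV c (R f xs)"
  by (induction xs arbitrary: f) (simp_all add: rho_scale V.scale_right_diff_distrib)

lemma multilinear_telescope: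
  assumes "multilinear scale scaleV f"
  shows "multilinear scale scaleV (T f)"
proof -
  have "T f (as @ (y + z) # bs) = T f (as @ y # bs) + T f (as @ z # bs)" for as bs y z
    using assms
  proof (induction as arbitrary: f)
    case Nil
    then show ?case by (simp add: dg_add shift_add multilinear_simps telescope_add)
  next
    case (Cons a as)
    then show ?case
      using multilinear_add_at[OF Cons.prems, of "dg a # as"] Cons.IH[OF multilinear_Cons[OF Cons.prems]]
      by simp
  qed
  moreover have "T f (as @ scale c y # bs) = scaleV c (T f (as @ y # bs))" for as bs c y
    using assms
  proof (induction as arbitrary: f)
    case Nil
    then show ?case
      by (simp add: dg_scale shift_scale multilinear_simps telescope_scale V.scale_right_distrib)
  next
    case (Cons a as)
    then show ?case
      using multilinear_scale_at[OF Cons.prems, of "dg a # as"] Cons.IH[OF multilinear_Cons[OF Cons.prems]]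
      by (simp add: V.scale_right_distrib)
  qed
  ultimately show ?thesis by (simp add: multilinear_def)
qed

text \<open>With \<open>y\<close> twice in front, \<open>f(shift y, dg y, ...)\<close> reduces to
  \<open>f(y, dg y, ...)\<close>, which cancels \<open>f(dg y, y, ...)\<close>; the remaining term
  starts with two copies of \<open>shift y\<close>.\<close>

lemma alternating_telescope:
  assumes "multilinear scale scaleV f" "alternating f"
  shows "alternating (T f)"
proof -
  have "T f (as @ y # y # bs) = 0" for as bs y
    using assms
  proof (induction as arbitrary: f)
    case Nil
    have z: "f (u # u # zs) = 0" for u zs
      using alternating_zero[OF Nil.prems(2), of "[]"] by simp
    have "f (dg y # y # bs) = - f (y # dg y # bs)"
      by (rule alternating_swap_front[OF Nil.prems])
    moreover have "f (shift y # dg y # bs) = f (y # dg y # bs)"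
      by (simp add: multilinear_shift[OF Nil.prems(1)] z)
    ultimately show ?case by (simp add: z telescope_zero)
  next
    case (Cons a as)
    then show ?case
      using alternating_zero[OF Cons.prems(2), of "dg a # as"]
        Cons.IH[OF multilinear_Cons[OF Cons.prems(1)] alternating_Cons[OF Cons.prems(2)]] by simp
  qed
  then show ?thesis by (simp add: alternating_def)
qed

section \<open>The common defect \<open>R\<close> of \<open>T\<close> and \<open>dV\<close>\<close>

lemma lie_deriv_rho_lam: "L' x f xs = L x f xs + scaleV lam (\<rho> (dg x) (f xs))"
  by (induction xs arbitrary: f) (simp_all add: rho_lam_expand)

lemma ce_diff_rho_lam: "d' f xs = d f xs + scaleV lam (R f xs)"
  by (induction xs arbitrary: f) (simp_all add: lie_deriv_rho_lam V.scale_right_diff_distrib)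

text \<open>The base case is the compatibility of \<open>dV\<close> with \<open>\<rho>\<close>,
  whose last two summands combine to \<open>\<rho>' x (dV v)\<close>.\<close>

lemma dV_lie_deriv: "dV (L x f xs) = \<rho> (dg x) (f xs) + L' x (\<lambda>zs. dV (f zs)) xs"
  by (induction xs arbitrary: f) (simp_all add: dV_rho rho_lam_expand dV_diff)

lemma dV_ce_diff: "dV (d f xs) = R f xs + d' (\<lambda>zs. dV (f zs)) xs"
  by (induction xs arbitrary: f) (simp_all add: dV_lie_deriv dV_diff)

text \<open>The left side collects the Lie derivatives that \<open>T (d f)\<close> produces from a
  first argument \<open>x\<close>.\<close>

lemma telescope_lie_deriv:
  assumes "multilinear scale scaleV f"
  shows "L (dg x) f xs + T (L (shift x) f) xs = \<rho> (dg x) (f xs) + L' x (T f) xs"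
  using assms
proof (induction xs arbitrary: f)
  case Nil
  then show ?case by (simp add: rho_lam_shift)
next
  case (Cons y ys)
  note ml = multilinear_Cons[OF Cons.prems]
  have "L (shift x) (\<lambda>zs. f (dg y # zs)) ys =
      L x (\<lambda>zs. f (dg y # zs)) ys + scaleV lam (L (dg x) (\<lambda>zs. f (dg y # zs)) ys)"
    unfolding shift_def by (simp add: lie_deriv_add_left[OF ml] lie_deriv_scale_left[OF ml])
  \<comment> \<open>The weighted Leibniz rule, its last two summands grouped as
    \<open>bracket (shift x) (dg y)\<close>.\<close>
  moreover have "f (dg (bracket x y) # ys) = f (bracket (dg x) y # ys) + f (bracket (shift x) (dg y) # ys)"
    using Cons.prems
    by (simp add: dg_bracket shift_def bracket_add_left bracket_scale_left multilinear_simps add_ac)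
  moreover have "L (dg x) (\<lambda>zs. f (shift y # zs)) ys =
      L (dg x) (\<lambda>zs. f (y # zs)) ys + scaleV lam (L (dg x) (\<lambda>zs. f (dg y # zs)) ys)"
    using Cons.prems by (simp add: multilinear_shift lie_deriv_add lie_deriv_scale)
  moreover have "\<rho> (dg x) (f (shift y # ys)) =
      \<rho> (dg x) (f (y # ys)) + scaleV lam (\<rho> (dg x) (f (dg y # ys)))"
    using Cons.prems by (simp add: multilinear_shift rho_add rho_scale)
  ultimately show ?case
    using Cons.IH[OF ml, of "shift y"]
    by (simp add: telescope_diff lam.lie_deriv_add bracket_shift
        lie_deriv_rho_lam[of x "\<lambda>zs. f (dg y # zs)"] algebra_simps)
qed

text \<open>With \<open>x\<close> split off, \<open>telescope_lie_deriv\<close> treats the Lie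
  derivatives and the induction hypothesis treats \<open>f(shift x, ...)\<close>. The surplus,
  \<open>lam\<close> times \<open>R\<close> of \<open>f(dg x, ...)\<close>, is the difference
  between \<open>d'\<close> and \<open>d\<close> there.\<close>

lemma telescope_ce_diff:
  assumes "multilinear scale scaleV f"
  shows "T (d f) xs = R f xs + d' (T f) xs"
  using assms
proof (induction xs arbitrary: f)
  case Nil
  then show ?case by simp
next
  case (Cons x xs)
  have "R (\<lambda>zs. f (shift x # zs)) xs = R (\<lambda>zs. f (x # zs)) xs + scaleV lam (R (\<lambda>zs. f (dg x # zs)) xs)"
    using Cons.prems by (simp add: multilinear_shift ce_action_add ce_action_scale)
  then show ?case
    using Cons.IH[OF multilinear_Cons[OF Cons.prems], of "shift x"]
      telescope_lie_deriv[OF Cons.prems, of x xs]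
    by (simp add: telescope_diff lam.ce_diff_add
        ce_diff_rho_lam[of "\<lambda>zs. f (dg x # zs)"] algebra_simps)
qed

section \<open>The explicit formula for \<open>delta\<close> and the cochain map\<close>

text \<open>Expanding \<open>shift x\<close> turns each nonempty index set of the tail into two,
  without and with the head, the latter with one more factor \<open>lam\<close>; \<open>{0}\<close>
  is the first term of \<open>telescope\<close>.\<close>

lemma telescope_sum_subsets:
  assumes "multilinear scale scaleV f"
  shows "T f xs =
    (\<Sum>I \<in> Pow {..<length xs} - {{}}. scaleV (lam ^ (card I - 1)) (f (apply_at dg I xs)))"
  using assms
proof (induction xs arbitrary: f)
  case Nil
  then show ?case by simp
next
  case (Cons x xs)
  have "scaleV (lam ^ (card J - 1)) (f (shift x # apply_at dg J xs)) =
      scaleV (lam ^ (card (Suc ` J) - 1)) (f (apply_at dg (Suc ` J) (x # xs))) +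
      scaleV (lam ^ (card (insert 0 (Suc ` J)) - 1)) (f (apply_at dg (insert 0 (Suc ` J)) (x # xs)))"
    if J: "J \<in> Pow {..<length xs} - {{}}" for J
  proof -
    have fin: "finite J" using J finite_subset[of J "{..<length xs}"] by simp
    \<comment> \<open>Nonemptiness makes \<open>card J - 1\<close> a true predecessor, so adding the
      head raises the exponent by one.\<close>
    then obtain m where m: "card J = Suc m" using J by (cases "card J") auto
    have sets: "{j. Suc j \<in> Suc ` J} = J" by auto
    have "apply_at dg (Suc ` J) (x # xs) = x # apply_at dg J xs"
      "apply_at dg (insert 0 (Suc ` J)) (x # xs) = dg x # apply_at dg J xs"
      by (auto simp: apply_at_Cons sets)
    moreover have "card (Suc ` J) = Suc m" "card (insert 0 (Suc ` J)) = Suc (Suc m)"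
      using fin m by (simp_all add: card_image)
    ultimately show ?thesis
      unfolding multilinear_shift[OF Cons.prems] V.scale_right_distrib
      by (simp only: m diff_Suc_1 V.scale_scale power_Suc2)
  qed
  then have "(\<Sum>J \<in> Pow {..<length xs} - {{}}. scaleV (lam ^ (card J - 1)) (f (shift x # apply_at dg J xs))) =
      (\<Sum>J \<in> Pow {..<length xs} - {{}}.
        scaleV (lam ^ (card (Suc ` J) - 1)) (f (apply_at dg (Suc ` J) (x # xs))) +
        scaleV (lam ^ (card (insert 0 (Suc ` J)) - 1)) (f (apply_at dg (insert 0 (Suc ` J)) (x # xs))))"
    by (rule sum.cong[OF refl])
  moreover have "scaleV (lam ^ (card {0::nat} - 1)) (f (apply_at dg {0} (x # xs))) = f (dg x # xs)"
    by (simp add: apply_at_Cons apply_at_empty)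
  ultimately show ?case
    unfolding telescope.simps Cons.IH[OF multilinear_Cons[OF Cons.prems]] length_Cons
      sum_nonempty_subsets_Suc by (simp only:)
qed

text \<open>The sizes \<open>k\<close> partition the nonempty subsets, so the double sum collapses
  to \<open>telescope_sum_subsets\<close>. Off degree \<open>n\<close> both sides vanish.\<close>

lemma delta_eq:
  assumes "f \<in> cochains scale scaleV n"
  shows "delta lam dg scaleV dV n f = (\<lambda>xs. T f xs - dV (f xs))"
proof
  fix xs
  have f: "multilinear scale scaleV f" "\<And>zs. length zs \<noteq> n \<Longrightarrow> f zs = 0"
    using assms by (auto simp: cochains_iff[OF vector_space_axioms V.vector_space_axioms])
  show "delta lam dg scaleV dV n f xs = T f xs - dV (f xs)"
  proof (cases "length xs = n")
    case True
    let ?N = "Pow {..<n} - {{}}"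
    let ?h = "\<lambda>I. scaleV (lam ^ (card I - 1)) (f (apply_at dg I xs))"
    have card: "card I \<in> {1..n}" if "I \<in> ?N" for I
    proof -
      have "finite I" using that finite_subset[of I "{..<n}"] by simp
      then show ?thesis using that card_mono[of "{..<n}" I] by (auto simp: Suc_le_eq card_gt_0_iff)
    qed
    have "{I. I \<subseteq> {..<n} \<and> card I = k} = {I \<in> ?N. card I = k}" if "k \<in> {1..n}" for k
      using that by auto
    then have "(\<Sum>k=1..n. scaleV (lam ^ (k - 1))
          (\<Sum>I \<in> {I. I \<subseteq> {..<n} \<and> card I = k}. f (apply_at dg I xs))) =
        (\<Sum>k=1..n. \<Sum>I \<in> {I \<in> ?N. card I = k}. ?h I)"
      by (intro sum.cong) (simp_all add: V.scale_sum_right)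
    also have "\<dots> = sum ?h ?N"
      using card by (intro sum.group) (simp, simp, blast)
    finally show ?thesis
      using True by (simp add: delta_def telescope_sum_subsets[OF f(1)])
  next
    case False
    then show ?thesis using f(2) by (simp add: delta_def telescope_local)
  qed
qed

lemma linear_between_delta:
  "linear_between (scale_cochain scaleV) (scale_cochain scaleV)
    (cochains scale scaleV n) (cochains scale scaleV n) (delta lam dg scaleV dV n)"
proof -
  interpret C: vector_space "scale_cochain scaleV" by (rule vector_space_cochain)
  have "delta lam dg scaleV dV n f \<in> cochains scale scaleV n" if "f \<in> cochains scale scaleV n" for f
  proof -
    have f: "multilinear scale scaleV f" "alternating f" "\<And>zs. length zs \<noteq> n \<Longrightarrow> f zs = 0"
      using that by (auto simp: cochains_iff[OF vector_space_axioms V.vector_space_axioms])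
    have "T f \<in> cochains scale scaleV n"
      using f multilinear_telescope[OF f(1)] alternating_telescope[OF f(1,2)]
      by (auto simp: cochains_iff[OF vector_space_axioms V.vector_space_axioms] intro!: telescope_local)
    moreover have "(\<lambda>xs. dV (f xs)) \<in> cochains scale scaleV n"
      using f by (simp add: cochains_iff[OF vector_space_axioms V.vector_space_axioms]
          multilinear_def alternating_def dV_add dV_scale)
    ultimately have "T f - (\<lambda>xs. dV (f xs)) \<in> cochains scale scaleV n"
      by (rule C.subspace_diff[OF subspace_cochains])
    then show ?thesis by (simp add: delta_eq[OF that] fun_diff_def)
  qed
  moreover have "delta lam dg scaleV dV n (f + g) = delta lam dg scaleV dV n f + delta lam dg scaleV dV n g"
    if "f \<in> cochains scale scaleV n" "g \<in> cochains scale scaleV n" for f g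
    using that C.subspace_add[OF subspace_cochains that]
    by (simp add: delta_eq plus_fun_def telescope_add dV_add algebra_simps)
  moreover have "delta lam dg scaleV dV n (scale_cochain scaleV c f) =
      scale_cochain scaleV c (delta lam dg scaleV dV n f)"
    if "f \<in> cochains scale scaleV n" for c f
    using that C.subspace_scale[OF subspace_cochains that, of c]
    by (simp add: delta_eq scale_cochain_def telescope_scale dV_scale V.scale_right_diff_distrib)
  ultimately show ?thesis unfolding linear_between_def by blast
qed

text \<open>\<open>delta\<close> keeps the degree, so both coboundaries carry the same sign and only
  \<open>d'\<close>, \<open>d\<close>, \<open>T\<close> and \<open>dV\<close> have to be
  compared.\<close>

lemma do_coboundary_delta:
  assumes f: "f \<in> cochains scale scaleV n"
  shows "do_coboundary scale bracket lam dg scaleV \<rho> n (delta lam dg scaleV dV n f) =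
    delta lam dg scaleV dV (n + 1) (lie_coboundary bracket scaleV \<rho> n f)"
proof -
  have ml: "multilinear scale scaleV f"
    using f by (simp add: cochains_iff[OF vector_space_axioms V.vector_space_axioms])
  have mem: "delta lam dg scaleV dV n f \<in> cochains scale scaleV n"
    using linear_between_delta f unfolding linear_between_def by blast
  have "do_coboundary scale bracket lam dg scaleV \<rho> n (delta lam dg scaleV dV n f) =
      (\<lambda>xs. scaleV ((- 1) ^ (n + 1)) (d' (\<lambda>zs. T f zs - dV (f zs)) xs))"
    unfolding do_coboundary_def lam.lie_coboundary_eq[OF mem] unfolding delta_eq[OF f] ..
  \<comment> \<open>The terms \<open>R f\<close> contributed by \<open>T\<close> and by
    \<open>dV\<close> cancel here.\<close>
  also have "\<dots> = (\<lambda>xs. scaleV ((- 1) ^ (n + 1)) (T (d f) xs - dV (d f xs)))"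
    by (simp add: lam.ce_diff_diff telescope_ce_diff[OF ml] dV_ce_diff)
  also have "\<dots> = delta lam dg scaleV dV (n + 1) (lie_coboundary bracket scaleV \<rho> n f)"
    unfolding delta_eq[OF lie_coboundary_in_cochains[OF f]]
    unfolding lie_coboundary_eq[OF f] telescope_scale dV_scale V.scale_right_diff_distrib ..
  finally show ?thesis .
qed

lemma cochain_map_delta:
  "cochain_map
    (scale_cochain scaleV) (cochains scale scaleV) (lie_coboundary bracket scaleV \<rho>)
    (scale_cochain scaleV) (cochains scale scaleV) (do_coboundary scale bracket lam dg scaleV \<rho>)
    (delta lam dg scaleV dV)"
  unfolding cochain_map_def
  using cochain_complex_lie_coboundary lam.cochain_complex_lie_coboundary linear_between_delta
    do_coboundary_delta by (simp add: do_coboundary_def)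

end

theorem proposition1p9:
  fixes scale :: "'k::field_char_0 \<Rightarrow> 'g::ab_group_add \<Rightarrow> 'g"
    and bracket :: "'g \<Rightarrow> 'g \<Rightarrow> 'g"
    and lam :: 'k
    and dg :: "'g \<Rightarrow> 'g"
    and scaleV :: "'k \<Rightarrow> 'v::ab_group_add \<Rightarrow> 'v"
    and \<rho> :: "'g \<Rightarrow> 'v \<Rightarrow> 'v"
    and dV :: "'v \<Rightarrow> 'v"
  assumes "differential_lie_algebra scale bracket lam dg"
    and "differential_representation scale bracket lam dg scaleV \<rho> dV"
  shows "cochain_map
    (scale_cochain scaleV) (cochains scale scaleV) (lie_coboundary bracket scaleV \<rho>)
    (scale_cochain scaleV) (cochains scale scaleV) (do_coboundary scale bracket lam dg scaleV \<rho>)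
    (delta lam dg scaleV dV)"
  using assms(2) by (rule differential_representation.cochain_map_delta)

end
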